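(* Let $s$ and $a_1,\dots,a_{s+1}$ be positive integers. Let $G$ be a plane convex caterpillar with vertices $v_1,\dots,v_s,v_{s+1}$ in clockwise order on the spine such that each $v_i$ is adjacent to exactly $a_i$ leaves. If there exists a permutation $\sigma_1,\dots,\sigma_{s-1},\sigma_s$ of the set $\{1,\dots,s\}$ such that $\sigma_i\le\min\{a_i,a_{i+1}\}$ for all $i\in\{1,\dots,s\}$, then $G$ is strongly packable.
   Context: Graphs are finite and simple; $e(G)$ is the number of edges of $G$. A convex geometric graph (CGG) is a graph whose vertices are points in strictly convex position in the Euclidean plane and whose edges are straight line segments joining vertices. Its vertices are listed in clockwise cyclic order $u_0,\dots,u_{n-1}$ on the boundary of their convex hull (indices modulo $n$). A pair $\{u_i,u_{i+1}\}$ is an extremal pair. The length $\ell(x,y)$ of a pair of vertices is the minimum length of a path from $x$ to $y$ using only extremal pairs. A CGG is plane if no two of its edges cross. A plane path is a plane CGG whose underlying abstract graph is a path. A convex path is a plane path all of whose edges are extremal. A plane convex caterpillar is a plane CGG (a tree) such that deleting all leaves yields a convex path, called the spine; the spine edges are extremal pairs of the caterpillar itself, i.e. the spine vertices $v_1,\dots,v_{s+1}$ are consecutive in the cyclic order of all vertices of $G$, with spine edges $\{v_i,v_{i+1}\}$. CGGs $G_1,G_2$ are convex-isomorphic if there is a bijection $f:V(G_1)\to V(G_2)$ such that for all $x,y\in V(G_1)$: $\ell(x,y)=\ell(f(x),f(y))$ (lengths taken in $G_1$, resp. $G_2$), and $\{x,y\}\in E(G_1)$ if and only if $\{f(x),f(y)\}\in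 E(G_2)$. A subgraph of a CGG is regarded as a CGG on its own vertex set with the induced cyclic order. Let $\mathcal{K}_n$ be the complete CGG on $n$ vertices. For a subgraph $G'$ of $\mathcal{K}_n$, its length set $L_{G'}\subseteq\{1,\dots,\lfloor n/2\rfloor\}$ is the set of lengths, measured in $\mathcal{K}_n$, of the edges of $G'$. A CGG $G$ is strongly packable if for each $n\ge1$ there is a set $S_n$ of subsets of $\{1,\dots,\lfloor n/2\rfloor\}$ such that: (1) the sets in $S_n$ are pairwise disjoint and each has size $e(G)$; (2) for every $A\in S_n$ there is a subgraph $G_A$ of $\mathcal{K}_n$ convex-isomorphic to $G$ with $L_{G_A}=A$; (3) $\sum_{A\in S_n}|A|=|S_n|\,e(G)=(1-o(1))\,n/2$ as $n\to\infty$. *)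

theory Defs
  imports "HOL-Analysis.Analysis"
begin

text \<open>The Euclidean plane is the type of complex numbers. The cyclic order of a convex geometric
  graph is determined by the position of its vertices, so a subgraph automatically carries the
  induced cyclic order.\<close>

definition strictly_convex_position :: "complex set \<Rightarrow> bool" where
  "strictly_convex_position V \<longleftrightarrow> (\<forall>v\<in>V. v \<notin> convex hull (V - {v}))"

record cgg =
  verts :: "complex set"
  edges :: "complex set set"

definition is_cgg :: "cgg \<Rightarrow> bool" where
  "is_cgg G \<longleftrightarrow> finite (verts G) \<and> strictly_convex_position (verts G) \<and>
     (\<forall>e\<in>edges G. \<exists>x\<in>verts G. \<exists>y\<in>verts G. x \<noteq> y \<and> e = {x, y})"

text \<open>The expression below is the cross product of \<open>b - a\<close> and \<open>c - a\<close>; it is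
  negative iff the triangle \<open>a, b, c\<close> is traversed clockwise.\<close>

definition clockwise_triple :: "complex \<Rightarrow> complex \<Rightarrow> complex \<Rightarrow> bool" where
  "clockwise_triple a b c \<longleftrightarrow> Im (cnj (b - a) * (c - a)) < 0"

text \<open>For points in strictly convex position, a listing follows the boundary of the convex hull
  clockwise iff each of its three-element subsequences does.\<close>

definition clockwise_listing :: "complex set \<Rightarrow> complex list \<Rightarrow> bool" where
  "clockwise_listing V us \<longleftrightarrow> distinct us \<and> set us = V \<and>
     (\<forall>i j k. i < j \<and> j < k \<and> k < length us \<longrightarrow> clockwise_triple (us ! i) (us ! j) (us ! k))"

definition clockwise_next :: "complex set \<Rightarrow> complex \<Rightarrow> complex \<Rightarrow> bool" where
  "clockwise_next V x y \<longleftrightarrow> (\<exists>us i. clockwise_listing V us \<and> i < length us \<and>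
     x = us ! i \<and> y = us ! ((i + 1) mod length us))"

definition extremal_pair :: "complex set \<Rightarrow> complex \<Rightarrow> complex \<Rightarrow> bool" where
  "extremal_pair V x y \<longleftrightarrow> x \<noteq> y \<and> (clockwise_next V x y \<or> clockwise_next V y x)"

definition pair_length :: "complex set \<Rightarrow> complex \<Rightarrow> complex \<Rightarrow> nat" where
  "pair_length V x y = (LEAST k. (x, y) \<in> {(p, q). extremal_pair V p q} ^^ k)"

text \<open>Edges sharing an endpoint do not cross: their open segments are disjoint in strictly convex
  position.\<close>

definition plane_cgg :: "cgg \<Rightarrow> bool" where
  "plane_cgg G \<longleftrightarrow> is_cgg G \<and>
     (\<forall>a b c d. {a, b} \<in> edges G \<and> {c, d} \<in> edges G \<and> {a, b} \<noteq> {c, d} \<longrightarrow>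
        open_segment a b \<inter> open_segment c d = {})"

definition leaf :: "cgg \<Rightarrow> complex \<Rightarrow> bool" where
  "leaf G x \<longleftrightarrow> x \<in> verts G \<and> card {e \<in> edges G. x \<in> e} = 1"

definition tree_cgg :: "cgg \<Rightarrow> bool" where
  "tree_cgg G \<longleftrightarrow> verts G \<noteq> {} \<and>
     (\<forall>x\<in>verts G. \<forall>y\<in>verts G. (x, y) \<in> {(p, q). {p, q} \<in> edges G}\<^sup>*) \<and>
     \<not> (\<exists>xs. distinct xs \<and> 3 \<le> length xs \<and>
          (\<forall>i<length xs. {xs ! i, xs ! ((i + 1) mod length xs)} \<in> edges G))"

definition path_cgg :: "cgg \<Rightarrow> bool" where
  "path_cgg P \<longleftrightarrow> (\<exists>ps. ps \<noteq> [] \<and> distinct ps \<and> verts P = set ps \<and>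
     edges P = {{ps ! i, ps ! (i + 1)} | i. i + 1 < length ps})"

definition convex_path :: "cgg \<Rightarrow> bool" where
  "convex_path P \<longleftrightarrow> plane_cgg P \<and> path_cgg P \<and>
     (\<forall>x y. {x, y} \<in> edges P \<longrightarrow> extremal_pair (verts P) x y)"

definition delete_leaves :: "cgg \<Rightarrow> cgg" where
  "delete_leaves G = \<lparr>verts = {x \<in> verts G. \<not> leaf G x},
     edges = {e \<in> edges G. \<forall>x\<in>e. \<not> leaf G x}\<rparr>"

text \<open>The spine edges are required to be extremal in the caterpillar, not only in the spine.\<close>

definition plane_convex_caterpillar :: "cgg \<Rightarrow> bool" where
  "plane_convex_caterpillar G \<longleftrightarrow> plane_cgg G \<and> tree_cgg G \<and> convex_path (delete_leaves G) \<and>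
     (\<forall>x y. {x, y} \<in> edges (delete_leaves G) \<longrightarrow> extremal_pair (verts G) x y)"

definition clockwise_spine :: "cgg \<Rightarrow> nat \<Rightarrow> (nat \<Rightarrow> complex) \<Rightarrow> bool" where
  "clockwise_spine G s v \<longleftrightarrow> bij_betw v {1..s + 1} (verts (delete_leaves G)) \<and>
     (\<forall>i\<in>{1..s}. {v i, v (i + 1)} \<in> edges (delete_leaves G) \<and>
        clockwise_next (verts G) (v i) (v (i + 1)))"

definition convex_isomorphic :: "cgg \<Rightarrow> cgg \<Rightarrow> bool" where
  "convex_isomorphic G H \<longleftrightarrow> (\<exists>f. bij_betw f (verts G) (verts H) \<and>
     (\<forall>x\<in>verts G. \<forall>y\<in>verts G.
        pair_length (verts G) x y = pair_length (verts H) (f x) (f y) \<and>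
        ({x, y} \<in> edges G \<longleftrightarrow> {f x, f y} \<in> edges H)))"

definition sub_cgg :: "cgg \<Rightarrow> cgg \<Rightarrow> bool" where
  "sub_cgg H K \<longleftrightarrow> is_cgg H \<and> verts H \<subseteq> verts K \<and> edges H \<subseteq> edges K"

definition complete_cgg :: "nat \<Rightarrow> cgg \<Rightarrow> bool" where
  "complete_cgg n K \<longleftrightarrow> is_cgg K \<and> card (verts K) = n \<and>
     edges K = {{x, y} | x y. x \<in> verts K \<and> y \<in> verts K \<and> x \<noteq> y}"

definition length_set :: "cgg \<Rightarrow> cgg \<Rightarrow> nat set" where
  "length_set K H = {pair_length (verts K) x y | x y. {x, y} \<in> edges H}"

text \<open>The complete convex geometric graph on \<open>n\<close> vertices is unique only up to convex
  isomorphism. The sets \<open>S n\<close> are chosen first and have to work for every realisation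
  \<open>K\<close>.\<close>

definition strongly_packable :: "cgg \<Rightarrow> bool" where
  "strongly_packable G \<longleftrightarrow> (\<exists>S :: nat \<Rightarrow> nat set set.
     (\<forall>n\<ge>1.
        (\<forall>A\<in>S n. A \<subseteq> {1..n div 2} \<and> card A = card (edges G)) \<and>
        pairwise disjnt (S n) \<and>
        (\<forall>K. complete_cgg n K \<longrightarrow>
           (\<forall>A\<in>S n. \<exists>H. sub_cgg H K \<and> convex_isomorphic H G \<and> length_set K H = A))) \<and>
     (\<exists>\<epsilon> :: nat \<Rightarrow> real. \<epsilon> \<longlonglongrightarrow> 0 \<and>
        (\<forall>n\<ge>1. real (\<Sum>A\<in>S n. card A) = (1 - \<epsilon> n) * (real n / 2))))"

lemma complete_cgg_exists:
  assumes "1 \<le> n"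
  shows "\<exists>K. complete_cgg n K"
proof -
  define V where "V = {z::complex. z ^ n = 1}"
  have V: "finite V" "card V = n"
    using assms unfolding V_def by (simp_all add: finite_roots_unity card_roots_unity_eq)
  have norm_V: "norm z = 1" if "z \<in> V" for z
  proof -
    have "norm z ^ n = 1" using that by (simp add: V_def flip: norm_power)
    then show ?thesis using power_eq_imp_eq_base[of "norm z" n 1] assms by simp
  qed
  have "strictly_convex_position V"
    unfolding strictly_convex_position_def
  proof (intro ballI notI)
    fix v assume v: "v \<in> V" "v \<in> convex hull (V - {v})"
    have "V - {v} \<subseteq> {z. inner v z < 1}"
    proof
      fix z assume z: "z \<in> V - {v}"
      have "0 < norm (v - z) ^ 2" using z by auto
      also have "\<dots> = norm v ^ 2 + norm z ^ 2 - 2 * inner v z"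
        by (simp add: power2_norm_eq_inner inner_diff inner_commute)
      finally show "z \<in> {z. inner v z < 1}" using norm_V v(1) z by simp
    qed
    then have "convex hull (V - {v}) \<subseteq> {z. inner v z < 1}"
      by (rule hull_minimal) (rule convex_halfspace_lt)
    then have "inner v v < 1" using v(2) by auto
    then show False using norm_V[OF v(1)] by (simp add: dot_square_norm)
  qed
  then have "complete_cgg n \<lparr>verts = V,
      edges = {{x, y} | x y. x \<in> V \<and> y \<in> V \<and> x \<noteq> y}\<rparr>"
    using V by (auto simp: complete_cgg_def is_cgg_def)
  then show ?thesis by blast
qed

end

theory Submission
  imports Defs
begin

text \<open>In clockwise order from \<open>v\<^sub>1\<close> the caterpillar consists of the spine, then the leaves of
  \<open>v\<^sub>s\<^sub>+\<^sub>1\<close>, then those of \<open>v\<^sub>s\<close>, and so on, since edges to leaves in any other order would cross.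
  With \<open>e\<close> edges and \<open>M = \<lfloor>n/2\<rfloor> div e\<close>, cut \<open>{1..e M}\<close> into \<open>e\<close> intervals of length \<open>M\<close>.
  In the copy with index \<open>t\<close> the edge \<open>v\<^sub>i v\<^sub>i\<^sub>+\<^sub>1\<close> takes length number \<open>t\<close> of interval \<open>\<sigma>\<^sub>i\<close>, and the leaf
  edges at \<open>v\<^sub>i\<close> take the \<open>t\<close>-th window of \<open>a\<^sub>i\<close> consecutive lengths in a union of \<open>a\<^sub>i\<close> intervals; these
  unions follow each other in the order \<open>v\<^sub>s\<^sub>+\<^sub>1, \<dots>, v\<^sub>1\<close>. The windows of \<open>v\<^sub>i\<^sub>+\<^sub>1\<close> and \<open>v\<^sub>i\<close> start at
  distance \<open>a\<^sub>i\<^sub>+\<^sub>1 (M - t) + a\<^sub>i t \<ge> min(a\<^sub>i, a\<^sub>i\<^sub>+\<^sub>1) M \<ge> \<sigma>\<^sub>i M\<close>, which leaves room for the spine edge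
  \<open>v\<^sub>i v\<^sub>i\<^sub>+\<^sub>1\<close>, so the leaves keep their cyclic order. Dropping the last \<open>s\<close> values of \<open>t\<close> absorbs
  the rounding.\<close>

section \<open>Clockwise listings\<close>

lemma clockwise_triple_iff:
  "clockwise_triple p q r \<longleftrightarrow>
     (Re q - Re p) * (Im r - Im p) - (Im q - Im p) * (Re r - Re p) < 0"
  by (simp add: clockwise_triple_def algebra_simps)

lemma clockwise_triple_rotate: "clockwise_triple p q r \<longleftrightarrow> clockwise_triple q r p"
  by (simp add: clockwise_triple_iff algebra_simps)

lemma clockwise_triple_asym: "clockwise_triple p q r \<Longrightarrow> \<not> clockwise_triple p r q"
  by (simp add: clockwise_triple_iff algebra_simps)

lemma clockwise_triple_cyclic:
  assumes "clockwise_listing V us" "i < length us" "j < length us" "k < length us"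
    and "i < j \<and> j < k \<or> j < k \<and> k < i \<or> k < i \<and> i < j"
  shows "clockwise_triple (us ! i) (us ! j) (us ! k)"
  using assms unfolding clockwise_listing_def by (metis clockwise_triple_rotate)

lemma mod_succ_cases:
  fixes i n :: nat
  assumes "i < n"
  shows "(i + 1) mod n = (if i + 1 = n then 0 else i + 1)"
  using assms by simp

text \<open>A consequence that no longer mentions the witnessing listing: all remaining points lie
  on the clockwise side of the line from \<open>x\<close> to \<open>y\<close>. This makes two
  listings comparable.\<close>

lemma clockwise_next_imp_triple:
  assumes "clockwise_next V x y" "x \<noteq> y" "z \<in> V" "z \<noteq> x" "z \<noteq> y"
  shows "clockwise_triple x y z"
proof -
  obtain us i where us: "clockwise_listing V us" "i < length us"
    and x: "x = us ! i" and y: "y = us ! ((i + 1) mod length us)"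
    using assms(1) unfolding clockwise_next_def by blast
  obtain k where k: "k < length us" "z = us ! k"
    using us(1) assms(3) unfolding clockwise_listing_def by (metis in_set_conv_nth)
  define j where "j = (i + 1) mod length us"
  have j: "j < length us" "j = (if i + 1 = length us then 0 else i + 1)"
    using us(2) mod_succ_cases[OF us(2)] by (auto simp: j_def split: if_splits)
  have "k \<noteq> i" "k \<noteq> j" "i \<noteq> j"
    using assms(2,4,5) x y k by (auto simp: j_def)
  then have "i < j \<and> j < k \<or> j < k \<and> k < i \<or> k < i \<and> i < j"
    using j us(2) k(1) by (auto split: if_splits)
  then show ?thesis
    using clockwise_triple_cyclic[OF us(1,2) j(1) k(1)] x y k(2) by (simp add: j_def)
qed

text \<open>\<open>clockwise_next\<close> allows any witnessing listing. If that listing gave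
  \<open>us ! i\<close> another successor than \<open>us\<close> does, then \<open>us ! i\<close>
  and the two candidates would form a triple of both orientations.\<close>

lemma clockwise_next_iff:
  assumes us: "clockwise_listing V us" and i: "i < length us" and j: "j < length us"
    and "i \<noteq> j"
  shows "clockwise_next V (us ! i) (us ! j) \<longleftrightarrow> j = (i + 1) mod length us"
proof
  assume next_ij: "clockwise_next V (us ! i) (us ! j)"
  show "j = (i + 1) mod length us"
  proof (rule ccontr)
    assume neq: "j \<noteq> (i + 1) mod length us"
    define k where "k = (i + 1) mod length us"
    have k: "k < length us" "k = (if i + 1 = length us then 0 else i + 1)"
      using i mod_succ_cases[OF i] by (auto simp: k_def split: if_splits)
    have k_neq: "k \<noteq> i" "k \<noteq> j"
      using neq k i j \<open>i \<noteq> j\<close> by (auto simp: k_def[symmetric] split: if_splits)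
    have dist: "distinct us" "set us = V"
      using us by (auto simp: clockwise_listing_def)
    have "clockwise_triple (us ! i) (us ! j) (us ! k)"
      using clockwise_next_imp_triple[OF next_ij] dist i j k(1) k_neq \<open>i \<noteq> j\<close>
      by (metis nth_eq_iff_index_eq nth_mem)
    moreover have "clockwise_triple (us ! i) (us ! k) (us ! j)"
    proof (rule clockwise_triple_cyclic[OF us i k(1) j])
      show "i < k \<and> k < j \<or> k < j \<and> j < i \<or> j < i \<and> i < k"
        using k k_neq i j \<open>i \<noteq> j\<close> by (cases "i < j") (auto split: if_splits)
    qed
    ultimately show False
      using clockwise_triple_asym by blast
  qed
next
  assume "j = (i + 1) mod length us"
  then show "clockwise_next V (us ! i) (us ! j)"
    using us i unfolding clockwise_next_def by blast
qed

lemma extremal_pair_iff: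
  assumes us: "clockwise_listing V us" and i: "i < length us" and j: "j < length us"
  shows "extremal_pair V (us ! i) (us ! j) \<longleftrightarrow>
    i \<noteq> j \<and> (j = (i + 1) mod length us \<or> i = (j + 1) mod length us)"
  using clockwise_next_iff[OF us i j] clockwise_next_iff[OF us j i] us i j
  by (auto simp: extremal_pair_def clockwise_listing_def nth_eq_iff_index_eq)

lemma extremal_pair_in: "extremal_pair V x y \<Longrightarrow> x \<in> V \<and> y \<in> V"
  unfolding extremal_pair_def clockwise_next_def clockwise_listing_def
  by (metis mod_less_divisor nth_mem gr_implies_not0 neq0_conv)

section \<open>Lengths of pairs as distances on the index cycle\<close>

definition cyclic_distance :: "nat \<Rightarrow> nat \<Rightarrow> nat \<Rightarrow> nat" where
  "cyclic_distance n i j = min (max i j - min i j) (n - (max i j - min i j))"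

lemma cyclic_distance_commute: "cyclic_distance n i j = cyclic_distance n j i"
  by (simp add: cyclic_distance_def max.commute min.commute)

text \<open>Extremal pairs are neighbours on the index cycle. Walks in the two directions realise
  both arcs, and one step changes the distance by at most one, so no walk is shorter than the
  smaller arc.\<close>

lemma pair_length_listing:
  assumes us: "clockwise_listing V us" and i: "i < length us" and j: "j < length us"
  shows "pair_length V (us ! i) (us ! j) = cyclic_distance (length us) i j"
proof -
  define n where "n = length us"
  define R where "R = {(p, q). extremal_pair V p q}"
  have step: "(us ! i, us ! ((i + 1) mod n)) \<in> R" "(us ! ((i + 1) mod n), us ! i) \<in> R"
    if "i < n" "1 < n" for i
  proof -
    have "(i + 1) mod n < n" "(i + 1) mod n \<noteq> i"
      using that mod_succ_cases[OF that(1)] by auto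
    then show "(us ! i, us ! ((i + 1) mod n)) \<in> R" "(us ! ((i + 1) mod n), us ! i) \<in> R"
      using that extremal_pair_iff[OF us] by (auto simp: R_def n_def)
  qed
  have forward: "(us ! i, us ! ((i + k) mod n)) \<in> R ^^ k"
    and backward: "(us ! ((i + k) mod n), us ! i) \<in> R ^^ k" if "i < n" "1 < n" for i k
  proof (induction k)
    case (Suc k)
    have eq: "((i + k) mod n + 1) mod n = (i + Suc k) mod n"
      by (simp add: mod_Suc_eq)
    have "(i + k) mod n < n" using that by simp
    from step[OF this that(2)] eq Suc show
      "(us ! i, us ! ((i + Suc k) mod n)) \<in> R ^^ Suc k"
      "(us ! ((i + Suc k) mod n), us ! i) \<in> R ^^ Suc k"
      by (metis relpow_Suc_I, metis relpow_Suc_I2)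
  qed (use that in auto)
  have reach: "(us ! i, us ! j) \<in> R ^^ cyclic_distance n i j" if ij: "i < n" "j < n" for i j
  proof (cases "i = j")
    case True
    then show ?thesis by (simp add: cyclic_distance_def)
  next
    case False
    then have n: "1 < n" using ij by linarith
    have diff: "(us ! i, us ! j) \<in> R ^^ (j - i) \<and> (us ! j, us ! i) \<in> R ^^ (j - i)"
      if "i \<le> j" "j < n" for i j
      using forward[of i "j - i"] backward[of i "j - i"] that n by auto
    have wrap: "(us ! j, us ! i) \<in> R ^^ (n - (j - i)) \<and> (us ! i, us ! j) \<in> R ^^ (n - (j - i))"
      if "i \<le> j" "j < n" for i j
    proof -
      have "(j + (n - (j - i))) mod n = i"
        using that by (simp add: mod_if)
      then show ?thesis
        using forward[of j "n - (j - i)"] backward[of j "n - (j - i)"] that n by auto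
    qed
    show ?thesis
    proof (cases "i \<le> j")
      case True
      then show ?thesis
        using diff[OF True ij(2)] wrap[OF True ij(2)]
        by (auto simp: cyclic_distance_def min_def max_def)
    next
      case False
      then have "j \<le> i" by simp
      then show ?thesis
        using diff[OF \<open>j \<le> i\<close> ij(1)] wrap[OF \<open>j \<le> i\<close> ij(1)] False
        by (auto simp: cyclic_distance_def min_def max_def)
    qed
  qed
  have lower: "cyclic_distance n i j \<le> k"
    if "(us ! i, us ! j) \<in> R ^^ k" "i < n" "j < n" for i j k
    using that
  proof (induction k arbitrary: j)
    case 0
    then have "i = j"
      using us by (auto simp: clockwise_listing_def nth_eq_iff_index_eq n_def)
    then show ?case by (simp add: cyclic_distance_def)
  next
    case (Suc k)
    obtain y where y: "(us ! i, y) \<in> R ^^ k" "(y, us ! j) \<in> R"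
      using Suc.prems(1) by auto
    have "y \<in> V" using y(2) extremal_pair_in by (auto simp: R_def)
    then obtain l where l: "l < n" "y = us ! l"
      using us by (auto simp: clockwise_listing_def in_set_conv_nth n_def)
    have "cyclic_distance n i l \<le> k"
      using Suc.IH y(1) l Suc.prems by simp
    moreover have "j = (l + 1) mod n \<or> l = (j + 1) mod n"
      using y(2) l Suc.prems extremal_pair_iff[OF us] by (auto simp: R_def n_def)
    then have "cyclic_distance n i j \<le> cyclic_distance n i l + 1"
      using mod_succ_cases[OF l(1)] mod_succ_cases[OF Suc.prems(3)] l(1) Suc.prems(2,3)
      unfolding cyclic_distance_def by (auto split: if_splits simp: min_def max_def)
    ultimately show ?case by linarith
  qed
  show ?thesis
    unfolding pair_length_def R_def[symmetric] n_def[symmetric]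
    using reach lower i j n_def by (intro Least_equality) auto
qed

section \<open>Strict convexity, crossings and the existence of listings\<close>

lemma strictly_convex_position_subset:
  assumes "strictly_convex_position V" "W \<subseteq> V"
  shows "strictly_convex_position W"
  unfolding strictly_convex_position_def
proof (intro ballI notI)
  fix v assume "v \<in> W" "v \<in> convex hull (W - {v})"
  moreover have "convex hull (W - {v}) \<subseteq> convex hull (V - {v})"
    using assms(2) by (intro hull_mono) auto
  ultimately show False
    using assms unfolding strictly_convex_position_def by blast
qed

text \<open>Weighting each point by the doubled area of the triangle of the other three gives
  \<open>A p + C r = B q + D t\<close>. Both sides have the doubled area of the quadrilateral as
  total weight, so dividing by it yields the common point.\<close>

lemma crossing_chords:
  assumes "clockwise_triple p q r" "clockwise_triple p q t"
    "clockwise_triple p r t" "clockwise_triple q r t"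
  shows "open_segment p r \<inter> open_segment q t \<noteq> {}"
proof -
  define cr where "cr x y z = - ((Re y - Re x) * (Im z - Im x) - (Im y - Im x) * (Re z - Re x))"
    for x y z
  define A B C D where "A = cr q r t" and "B = cr p r t" and "C = cr p q t" and "D = cr p q r"
  have pos: "A > 0" "B > 0" "C > 0" "D > 0"
    using assms by (simp_all add: A_def B_def C_def D_def cr_def clockwise_triple_iff)
  have AC: "A + C = B + D"
    by (simp add: A_def B_def C_def D_def cr_def algebra_simps)
  define z where "z = (A / (A + C)) *\<^sub>R p + (C / (A + C)) *\<^sub>R r"
  have "A * Re p + C * Re r = B * Re q + D * Re t" "A * Im p + C * Im r = B * Im q + D * Im t"
    by (simp_all add: A_def B_def C_def D_def cr_def algebra_simps)
  then have z: "z = (B / (B + D)) *\<^sub>R q + (D / (B + D)) *\<^sub>R t"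
    unfolding z_def AC by (auto simp: complex_eq_iff simp flip: add_divide_distrib)
  have "p \<noteq> r" "q \<noteq> t"
    using assms(1,4) by (auto simp: clockwise_triple_iff)
  moreover have "1 - C / (A + C) = A / (A + C)" "1 - D / (B + D) = B / (B + D)"
    using pos by (auto simp: field_simps)
  moreover have "0 < C / (A + C)" "C / (A + C) < 1" "0 < D / (B + D)" "D / (B + D) < 1"
    using pos by simp_all
  ultimately have "z \<in> open_segment p r" "z \<in> open_segment q t"
    unfolding in_segment using z z_def by metis+
  then show ?thesis by blast
qed

text \<open>Cramer's rule for \<open>x - v\<close> and \<open>z - v\<close> gives barycentric
  coordinates of \<open>y\<close>. The failing orientation says precisely that the coordinate
  \<open>(C - A - B) / C\<close> of \<open>v\<close> is nonnegative.\<close>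

lemma not_clockwise_imp_in_hull:
  assumes xy: "clockwise_triple v x y" and yz: "clockwise_triple v y z"
    and xz: "clockwise_triple v x z" and "\<not> clockwise_triple x y z"
  shows "y \<in> convex hull {v, x, z}"
proof -
  define cr where "cr p q = - ((Re p - Re v) * (Im q - Im v) - (Im p - Im v) * (Re q - Re v))"
    for p q
  define A B C where "A = cr y z" and "B = cr x y" and "C = cr x z"
  have pos: "A > 0" "B > 0" "C > 0"
    using xy yz xz by (simp_all add: A_def B_def C_def cr_def clockwise_triple_iff)
  have le: "A + B \<le> C"
    using assms(4) by (simp add: A_def B_def C_def cr_def clockwise_triple_iff algebra_simps)
  have "C * (Re y - Re v) = A * (Re x - Re v) + B * (Re z - Re v)"
    "C * (Im y - Im v) = A * (Im x - Im v) + B * (Im z - Im v)"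
    by (simp_all add: A_def B_def C_def cr_def algebra_simps)
  then have "C * Re y = (C - A - B) * Re v + A * Re x + B * Re z"
    "C * Im y = (C - A - B) * Im v + A * Im x + B * Im z"
    by (simp_all add: algebra_simps)
  then have "y = ((C - A - B) / C) *\<^sub>R v + (A / C) *\<^sub>R x + (B / C) *\<^sub>R z"
    using pos(3) by (auto simp: complex_eq_iff simp: field_simps)
  moreover have "(C - A - B) / C + A / C + B / C = 1" "(C - A - B) / C \<ge> 0" "A / C \<ge> 0" "B / C \<ge> 0"
    using pos le by (simp_all add: field_simps)
  ultimately show ?thesis
    unfolding convex_hull_3 by blast
qed

text \<open>Seen from \<open>v\<close>, all other points lie in an open half-plane, so they can be
  sorted by slope.\<close>

lemma clockwise_listing_exists:
  assumes fin: "finite V" and scp: "strictly_convex_position V" and v: "v \<in> V"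
  shows "\<exists>us. clockwise_listing V us \<and> us ! 0 = v"
proof -
  define W where "W = V - {v}"
  have finW: "finite W" using fin by (simp add: W_def)
  have "closed (convex hull W)" "v \<notin> convex hull W"
    using scp v finW by (auto simp: strictly_convex_position_def W_def
        intro: compact_imp_closed finite_imp_compact_convex_hull)
  then obtain w b where w: "w \<bullet> v < b" "\<And>x. x \<in> convex hull W \<Longrightarrow> b < w \<bullet> x"
    using separating_hyperplane_closed_point[of "convex hull W" v] by auto
  \<comment> \<open>Coordinates of \<open>x - v\<close> along \<open>w\<close> and perpendicular to
    it, scaled by the norm of \<open>w\<close>; the separation makes \<open>X\<close> positive on
    \<open>W\<close>.\<close>
  define X where "X x = w \<bullet> (x - v)" for x
  define Y where "Y x = Re w * Im (x - v) - Im w * Re (x - v)" for x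
  have X_pos: "X x > 0" if "x \<in> W" for x
    using w(1) w(2)[OF hull_inc[OF that]] by (simp add: X_def inner_diff_right)
  have norm_w: "(Re w)\<^sup>2 + (Im w)\<^sup>2 > 0" if "x \<in> W" for x
    using X_pos[OF that] by (auto simp: X_def sum_power2_gt_zero_iff inner_complex_def)
  have cross: "X x * Y y - Y x * X y = ((Re w)\<^sup>2 + (Im w)\<^sup>2) *
      ((Re x - Re v) * (Im y - Im v) - (Im x - Im v) * (Re y - Re v))" for x y
    by (simp add: X_def Y_def inner_complex_def algebra_simps power2_eq_square)
  \<comment> \<open>The sign makes slopes increase in clockwise order around
    \<open>v\<close>.\<close>
  define slope where "slope x = - (Y x / X x)" for x
  have slope_iff: "clockwise_triple v x y \<longleftrightarrow> slope x < slope y" if "x \<in> W" "y \<in> W" for x y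
  proof -
    have "slope x < slope y \<longleftrightarrow> X x * Y y - Y x * X y < 0"
      using X_pos[OF that(1)] X_pos[OF that(2)] by (simp add: slope_def field_simps)
    also have "\<dots> \<longleftrightarrow> clockwise_triple v x y"
      using norm_w[OF that(1)] by (simp add: cross clockwise_triple_iff mult_less_0_iff)
    finally show ?thesis by simp
  qed
  \<comment> \<open>Points of equal slope lie on one ray from \<open>v\<close>, so the nearer one is
    on the segment from \<open>v\<close> to the other, against strict convexity.\<close>
  have collinear: False if xy: "x \<in> W" "y \<in> W" "x \<noteq> y" "slope x = slope y" "X x \<le> X y" for x y
  proof -
    define u where "u = X x / X y"
    have u: "0 \<le> u" "u \<le> 1" "X x = u * X y"
      using X_pos[OF xy(1)] X_pos[OF xy(2)] xy(5) by (simp_all add: u_def)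
    have Yu: "Y x = u * Y y"
      using xy(4) X_pos[OF xy(1)] X_pos[OF xy(2)] by (simp add: slope_def u_def field_simps)
    have "((Re w)\<^sup>2 + (Im w)\<^sup>2) * Re (x - v) = Re w * X x - Im w * Y x"
      "((Re w)\<^sup>2 + (Im w)\<^sup>2) * Im (x - v) = Im w * X x + Re w * Y x" for x
      by (simp_all add: X_def Y_def inner_complex_def algebra_simps power2_eq_square)
    note coords = this
    have "((Re w)\<^sup>2 + (Im w)\<^sup>2) * Re (x - v) = ((Re w)\<^sup>2 + (Im w)\<^sup>2) * (u * Re (y - v))"
      "((Re w)\<^sup>2 + (Im w)\<^sup>2) * Im (x - v) = ((Re w)\<^sup>2 + (Im w)\<^sup>2) * (u * Im (y - v))"
      unfolding mult.left_commute[of _ u] coords by (simp_all add: u(3) Yu algebra_simps)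
    then have "Re (x - v) = u * Re (y - v)" "Im (x - v) = u * Im (y - v)"
      using norm_w[OF xy(1)] by (auto simp del: minus_complex.simps)
    then have "x = (1 - u) *\<^sub>R v + u *\<^sub>R y"
      by (simp add: complex_eq_iff algebra_simps)
    then have "x \<in> convex hull {v, y}"
      using u unfolding segment_convex_hull[symmetric] in_segment by blast
    moreover have "convex hull {v, y} \<subseteq> convex hull (V - {x})"
      using xy v by (intro hull_mono) (auto simp: W_def)
    ultimately show False
      using scp xy(1) by (auto simp: strictly_convex_position_def W_def)
  qed
  have inj: "inj_on slope W"
  proof (rule inj_onI, rule ccontr)
    fix x y assume "x \<in> W" "y \<in> W" "slope x = slope y" "x \<noteq> y"
    then show False
      using collinear[of x y] collinear[of y x] by (cases "X x \<le> X y") auto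
  qed
  define vs where "vs = map (inv_into W slope) (sorted_list_of_set (slope ` W))"
  have map_slope: "map slope vs = sorted_list_of_set (slope ` W)"
    using finW by (auto simp: vs_def comp_def f_inv_into_f intro!: map_idI)
  have set_vs: "set vs = W"
    using finW inj by (simp add: vs_def)
  have "distinct vs"
    using distinct_map[of slope vs] map_slope by simp
  have len: "length vs = length (sorted_list_of_set (slope ` W))"
    by (simp add: vs_def)
  have slope_less: "slope (vs ! i) < slope (vs ! j)" if "i < j" "j < length vs" for i j
  proof -
    have "slope (vs ! k) = sorted_list_of_set (slope ` W) ! k" if "k < length vs" for k
      using nth_map[OF that, of slope] by (simp add: map_slope)
    then show ?thesis
      using strict_sorted_list_of_set[of "slope ` W"] that
      by (simp add: sorted_wrt_iff_nth_less len)
  qed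
  have triple: "clockwise_triple v (vs ! i) (vs ! j)" if "i < j" "j < length vs" for i j
    using slope_less[OF that] slope_iff[of "vs ! i" "vs ! j"] that set_vs
    by (metis nth_mem less_trans)
  \<comment> \<open>Sorting controls only triples through \<open>v\<close>; in any other triple a
    wrong orientation would put the middle point into the hull of three other points.\<close>
  have "clockwise_triple (vs ! i) (vs ! j) (vs ! k)" if ijk: "i < j" "j < k" "k < length vs" for i j k
  proof (rule ccontr)
    assume "\<not> ?thesis"
    then have "vs ! j \<in> convex hull {v, vs ! i, vs ! k}"
      using triple ijk by (intro not_clockwise_imp_in_hull) auto
    moreover have in_W: "vs ! i \<in> W" "vs ! j \<in> W" "vs ! k \<in> W"
      using ijk unfolding set_vs[symmetric] by simp_all
    have "vs ! i \<noteq> vs ! j" "vs ! k \<noteq> vs ! j"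
      using \<open>distinct vs\<close> ijk by (auto simp: nth_eq_iff_index_eq)
    then have "convex hull {v, vs ! i, vs ! k} \<subseteq> convex hull (V - {vs ! j})"
      using in_W v by (intro hull_mono) (auto simp: W_def)
    ultimately show False
      using scp in_W by (auto simp: strictly_convex_position_def W_def)
  qed
  then have "clockwise_triple ((v # vs) ! i) ((v # vs) ! j) ((v # vs) ! k)"
    if "i < j" "j < k" "k < length (v # vs)" for i j k
    using that triple by (auto simp: nth_Cons split: nat.splits)
  moreover have "distinct (v # vs)" "set (v # vs) = V"
    using set_vs \<open>distinct vs\<close> v by (auto simp: W_def)
  ultimately have "clockwise_listing V (v # vs)"
    unfolding clockwise_listing_def by blast
  then show ?thesis by (intro exI[of _ "v # vs"]) simp
qed

text \<open>Lengths depend on indices alone, so matching entries of equal index preserves them, and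
  the common index pattern \<open>P\<close> takes care of the edges.\<close>

lemma convex_isomorphic_listing:
  assumes hs: "clockwise_listing (verts H) hs" and us: "clockwise_listing (verts G) us"
    and len: "length hs = length us"
    and P: "P \<subseteq> Pow {..<length us}"
    and edges: "edges H = (`) ((!) hs) ` P" "edges G = (`) ((!) us) ` P"
  shows "convex_isomorphic H G"
proof -
  define I where "I = {..<length us}"
  have bij: "bij_betw ((!) hs) I (verts H)" "bij_betw ((!) us) I (verts G)"
    using hs us len by (auto simp: I_def clockwise_listing_def intro: bij_betw_nth)
  define f where "f = (!) us \<circ> inv_into I ((!) hs)"
  have f_nth: "f (hs ! i) = us ! i" if "i \<in> I" for i
    using bij(1) that by (simp add: f_def bij_betw_inv_into_left)
  have edge_iff: "{ws ! i, ws ! j} \<in> (`) ((!) ws) ` P \<longleftrightarrow> {i, j} \<in> P"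
    if "inj_on ((!) ws) I" "i \<in> I" "j \<in> I" for ws :: "complex list" and i j
  proof
    assume "{ws ! i, ws ! j} \<in> (`) ((!) ws) ` P"
    then obtain p where p: "p \<in> P" "(!) ws ` {i, j} = (!) ws ` p" by auto
    then have "{i, j} = p"
      using inj_on_image_eq_iff[OF that(1), of "{i, j}" p] P that by (auto simp: I_def)
    then show "{i, j} \<in> P" using p by simp
  qed (auto intro!: image_eqI[of _ _ "{i, j}"])
  have "bij_betw f (verts H) (verts G)"
    unfolding f_def using bij by (blast intro: bij_betw_trans bij_betw_inv_into)
  moreover have "pair_length (verts H) x y = pair_length (verts G) (f x) (f y) \<and>
      ({x, y} \<in> edges H \<longleftrightarrow> {f x, f y} \<in> edges G)" if "x \<in> verts H" "y \<in> verts H" for x y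
  proof -
    obtain i j where ij: "i \<in> I" "x = hs ! i" "j \<in> I" "y = hs ! j"
      using bij(1) \<open>x \<in> verts H\<close> \<open>y \<in> verts H\<close> unfolding bij_betw_def by blast
    then have "pair_length (verts H) x y = pair_length (verts G) (f x) (f y)"
      using pair_length_listing[OF hs] pair_length_listing[OF us] len
      by (simp add: f_nth) (simp add: I_def)
    moreover have "{x, y} \<in> edges H \<longleftrightarrow> {f x, f y} \<in> edges G"
      unfolding edges using edge_iff[of hs i j] edge_iff[of us i j] ij bij
      by (simp add: f_nth bij_betw_def)
    ultimately show ?thesis by blast
  qed
  ultimately show ?thesis
    unfolding convex_isomorphic_def by (intro exI[of _ f]) blast
qed

section \<open>Edge lengths of the copies\<close>

text \<open>Only the numerical hypotheses, so that lengths and positions are settled before any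
  graph enters.\<close>

locale caterpillar_shape =
  fixes s :: nat and a \<sigma> :: "nat \<Rightarrow> nat"
  assumes s_pos: "1 \<le> s"
    and a_pos: "\<And>i. i \<in> {1..s + 1} \<Longrightarrow> 1 \<le> a i"
    and \<sigma>_permutes: "\<sigma> permutes {1..s}"
    and \<sigma>_le: "\<And>i. i \<in> {1..s} \<Longrightarrow> \<sigma> i \<le> min (a i) (a (i + 1))"
begin

definition block :: "nat \<Rightarrow> nat" where
  "block i = s + 1 + (\<Sum>j\<in>{i<..s + 1}. a j)"

text \<open>The number of vertices; the number of edges is \<open>N - 1\<close>.\<close>

abbreviation N :: nat where
  "N \<equiv> block 0"

text \<open>Vertices are numbered clockwise from \<open>v 1\<close>, starting with 0: \<open>v i\<close> has number \<open>i - 1\<close> and its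
  leaves have the numbers from \<open>block i\<close> to \<open>block (i - 1) - 1\<close>. Rooting the tree at \<open>v 1\<close>, every
  edge joins a vertex \<open>q \<ge> 1\<close> to \<open>parent q < q\<close>.\<close>

definition owner :: "nat \<Rightarrow> nat" where
  "owner q = (LEAST i. block i \<le> q)"

definition parent :: "nat \<Rightarrow> nat" where
  "parent q = (if q \<le> s then q - 1 else owner q - 1)"

text \<open>Interval \<open>j\<close> is \<open>{(j - 1) * M + 1..j * M}\<close>. The spine edges
  use the intervals \<open>1\<close> to \<open>s\<close>; the leaves of \<open>v i\<close> share the
  intervals \<open>block i\<close> to \<open>block (i - 1) - 1\<close>, which are also the numbers
  of these leaves. The counter \<open>t\<close> starts at 0 and lengths at 1, hence the final
  \<open>+ 1\<close>.\<close>

definition edge_length :: "nat \<Rightarrow> nat \<Rightarrow> nat \<Rightarrow> nat" where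
  "edge_length M t q =
    (if q \<le> s then (\<sigma> q - 1) * M + t + 1
     else (block (owner q) - 1) * M + a (owner q) * t + (q - block (owner q)) + 1)"

definition spine_position :: "nat \<Rightarrow> nat \<Rightarrow> nat \<Rightarrow> nat" where
  "spine_position M t q = (\<Sum>i\<in>{1..q}. edge_length M t i)"

text \<open>The index of vertex \<open>q\<close> of the copy in a listing of the complete graph,
  with \<open>v 1\<close> at index 0.\<close>

definition position :: "nat \<Rightarrow> nat \<Rightarrow> nat \<Rightarrow> nat" where
  "position M t q =
    (if q \<le> s then spine_position M t q
     else spine_position M t (owner q - 1) + edge_length M t q)"

section \<open>Blocks of leaves and their owners\<close>

lemma block_Suc: "i \<le> s \<Longrightarrow> block i = block (Suc i) + a (Suc i)"
proof -
  assume "i \<le> s"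
  then have "{i<..s + 1} = insert (Suc i) {Suc i<..s + 1}" by auto
  then show ?thesis by (simp add: block_def)
qed

lemma block_last: "block (Suc s) = Suc s"
  by (simp add: block_def)

lemma block_ge: "s + 1 \<le> block i"
  by (simp add: block_def)

lemma block_antimono: "i \<le> j \<Longrightarrow> block j \<le> block i"
  unfolding block_def by (intro add_left_mono sum_mono2) auto

lemma owner_eqI:
  assumes "block i \<le> q" "q < block (i - 1)" "1 \<le> i"
  shows "owner q = i"
  unfolding owner_def
proof (rule Least_equality)
  fix j assume j: "block j \<le> q"
  show "i \<le> j"
  proof (rule ccontr)
    assume "\<not> i \<le> j"
    then have "block (i - 1) \<le> block j" by (intro block_antimono) auto
    then show False using j assms(2) by simp
  qed
qed fact

lemma owner_props:
  assumes "s < q" "q < N"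
  shows "1 \<le> owner q" "owner q \<le> s + 1" "block (owner q) \<le> q" "q < block (owner q) + a (owner q)"
proof -
  have last: "block (s + 1) \<le> q" using assms(1) by (simp add: block_last)
  show le: "block (owner q) \<le> q"
    unfolding owner_def by (rule LeastI[of _ "s + 1"]) (rule last)
  show "owner q \<le> s + 1"
    unfolding owner_def by (rule Least_le) (rule last)
  show ge: "1 \<le> owner q"
    using le assms(2) by (cases "owner q") auto
  have "\<not> block (owner q - 1) \<le> q"
    using ge not_less_Least[of "owner q - 1" "\<lambda>i. block i \<le> q"] by (simp add: owner_def)
  then show "q < block (owner q) + a (owner q)"
    using block_Suc[of "owner q - 1"] ge \<open>owner q \<le> s + 1\<close> by simp
qed

lemma parent_props:
  assumes "1 \<le> q" "q < N"
  shows "parent q < q" "parent q \<le> s"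
  using assms owner_props[of q] by (auto simp: parent_def not_le)

lemma \<sigma>_range: "i \<in> {1..s} \<Longrightarrow> \<sigma> i \<in> {1..s}"
  using \<sigma>_permutes by (simp add: permutes_in_image del: atLeastAtMost_iff)

text \<open>A spine vertex is placed relative to its predecessor and a leaf relative to its spine
  neighbour, so each edge spans exactly its prescribed length.\<close>

lemma position_parent:
  assumes "1 \<le> q" "q < N"
  shows "position M t q = position M t (parent q) + edge_length M t q"
proof (cases "q \<le> s")
  case True
  then show ?thesis
    using assms(1) by (cases q) (auto simp: position_def parent_def spine_position_def)
next
  case False
  then show ?thesis
    using owner_props[of q] assms(2) by (auto simp: position_def parent_def)
qed

section \<open>Bounds on lengths and the order of positions\<close>

lemma edge_length_pos: "1 \<le> edge_length M t q"
  by (simp add: edge_length_def)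

lemma spine_length_le:
  assumes "t < M" "q \<in> {1..s}"
  shows "edge_length M t q \<le> \<sigma> q * M"
proof -
  have "1 \<le> \<sigma> q" using \<sigma>_range[OF assms(2)] by simp
  then have "\<sigma> q * M = (\<sigma> q - 1) * M + M"
    by (metis Suc_diff_1 Suc_le_eq add.commute mult_Suc One_nat_def)
  then show ?thesis using assms by (simp add: edge_length_def)
qed

lemma leaf_offset_less:
  assumes "t < M" "s < q" "q < N"
  shows "a (owner q) * t + (q - block (owner q)) < a (owner q) * M"
proof -
  have "a (owner q) * t + (q - block (owner q)) < a (owner q) * Suc t"
    using owner_props[OF assms(2,3)] by simp
  also have "\<dots> \<le> a (owner q) * M"
    using assms(1) by (intro mult_le_mono2) simp
  finally show ?thesis .
qed

lemma leaf_length_le: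
  assumes "t < M" "s < q" "q < N"
  shows "edge_length M t q \<le> (block (owner q - 1) - 1) * M"
proof -
  note own = owner_props[OF assms(2,3)]
  have "edge_length M t q \<le> (block (owner q) - 1) * M + a (owner q) * M"
    using leaf_offset_less[OF assms] assms(2) by (simp add: edge_length_def)
  also have "\<dots> = (block (owner q) - 1 + a (owner q)) * M"
    by (simp add: algebra_simps)
  also have "\<dots> = (block (owner q - 1) - 1) * M"
    using block_Suc[of "owner q - 1"] own block_ge[of "owner q"] by simp
  finally show ?thesis .
qed

lemma edge_length_le:
  assumes "t < M" "1 \<le> q" "q < N"
  shows "edge_length M t q \<le> (N - 1) * M"
proof (cases "q \<le> s")
  case True
  have "edge_length M t q \<le> \<sigma> q * M"
    using spine_length_le assms True by simp
  also have "\<dots> \<le> (N - 1) * M"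
    using \<sigma>_range[of q] True assms(2) block_ge[of 0] by (intro mult_le_mono1) auto
  finally show ?thesis .
next
  case False
  then have q: "s < q" by simp
  have "edge_length M t q \<le> (block (owner q - 1) - 1) * M"
    using leaf_length_le[OF assms(1) q assms(3)] .
  also have "\<dots> \<le> (N - 1) * M"
    by (intro mult_le_mono1 diff_le_mono block_antimono) simp
  finally show ?thesis .
qed

text \<open>The delicate case is the passage from the last leaf of \<open>v (j + 1)\<close> to the
  first leaf of \<open>v j\<close>, because the reference point moves back along a spine
  edge.\<close>

lemma position_less_Suc:
  assumes t: "t + s < M" and q: "Suc q < N"
  shows "position M t q < position M t (Suc q)"
proof -
  consider "Suc q \<le> s" | "q = s" | "s < q" by linarith
  then show ?thesis
  proof cases
    case 1
    then show ?thesis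
      using edge_length_pos[of M t "Suc q"] by (simp add: position_def spine_position_def)
  next
    case 2
    have "block (s + 1) + a (s + 1) = block s"
      using block_Suc[of s] by simp
    then have "owner (Suc q) = s + 1"
      using 2 a_pos[of "s + 1"] by (intro owner_eqI) (simp_all add: block_last)
    then show ?thesis
      using 2 edge_length_pos[of M t "Suc q"] by (simp add: position_def)
  next
    case 3
    define i where "i = owner q"
    have own: "1 \<le> i" "i \<le> s + 1" "block i \<le> q" "q < block i + a i"
      using owner_props[of q] 3 q by (auto simp: i_def)
    have prev: "block (i - 1) = block i + a i"
      using block_Suc[of "i - 1"] own by simp
    show ?thesis
    proof (cases "Suc q < block i + a i")
      case True
      then have "owner (Suc q) = i"
        using own prev by (intro owner_eqI) auto
      then show ?thesis
        using 3 own by (simp add: position_def edge_length_def i_def[symmetric])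
    next
      case False
      then have Suc_q: "Suc q = block (i - 1)" using own prev by simp
      then have i: "2 \<le> i" using q own by (cases "i = 1") auto
      define j where "j = i - 1"
      have j: "j \<in> {1..s}" "i = Suc j" using i own by (auto simp: j_def)
      have "block (j - 1) = block j + a j"
        using block_Suc[of "j - 1"] j(1) by (cases j) auto
      then have own': "owner (Suc q) = j"
        using j(1) Suc_q[folded j_def] a_pos[of j] by (intro owner_eqI) simp_all
      have blocks: "Suc q = block j" "block j = block i + a i"
        using Suc_q prev by (simp_all add: j_def)
      have "spine_position M t j = spine_position M t (j - 1) + edge_length M t j"
        using j(1) by (cases j) (auto simp: spine_position_def)
      \<comment> \<open>The gain in leaf length has to exceed the spine edge between the two
        owners.\<close>
      moreover have "edge_length M t j + edge_length M t q < edge_length M t (Suc q)"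
      proof -
        have "(\<sigma> j - 1) * M + M = \<sigma> j * M"
          using \<sigma>_range[OF j(1)] by (cases "\<sigma> j") auto
        then have spine: "edge_length M t j + M = \<sigma> j * M + t + 1"
          using j(1) by (simp add: edge_length_def)
        have q_len: "edge_length M t q = (block i - 1) * M + a i * t + a i"
          using 3 blocks own by (simp add: edge_length_def i_def[symmetric])
        have "(block j - 1) * M = (block i - 1) * M + a i * M"
          using blocks block_ge[of i] by (simp add: algebra_simps flip: add_mult_distrib)
        then have Suc_len: "edge_length M t (Suc q) = (block i - 1) * M + a i * M + a j * t + 1"
          using 3 blocks own' by (simp add: edge_length_def)
        have \<sigma>: "\<sigma> j \<le> a i" "\<sigma> j \<le> a j" "\<sigma> j \<le> s"
          using \<sigma>_le[OF j(1)] \<sigma>_range[OF j(1)] j(2) by auto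
        \<comment> \<open>With \<open>M = r + t + 1\<close> the claim becomes \<open>\<sigma> j * r
          + \<sigma> j * t + \<sigma> j < a i * r + a j * t + r + 1\<close>. Excluding the last
          \<open>s\<close> values of \<open>t\<close> ensures
          \<open>\<sigma> j \<le> s \<le> r\<close>.\<close>
        define r where "r = M - Suc t"
        have r: "M = r + t + 1" "s \<le> r" using t by (simp_all add: r_def)
        have "\<sigma> j * r + \<sigma> j * t \<le> a i * r + a j * t"
          using \<sigma> by (intro add_mono mult_le_mono1)
        then show ?thesis
          using spine q_len Suc_len \<sigma>(3) r by (simp add: algebra_simps)
      qed
      ultimately show ?thesis
        using 3 own' by (simp add: position_def i_def[symmetric] j)
    qed
  qed
qed

lemma position_strict_mono:
  assumes "t + s < M" "p < q" "q < N"
  shows "position M t p < position M t q"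
  using assms(2,3)
proof (induction q)
  case (Suc q)
  have "position M t q < position M t (Suc q)"
    using position_less_Suc[OF assms(1)] Suc.prems by simp
  then show ?case
    using Suc by (cases "p = q") auto
qed simp

text \<open>By monotonicity the last leaf of \<open>v 1\<close> lies furthest, and as
  \<open>v 1\<close> is at 0, the position of this leaf is its edge length.\<close>

lemma position_le:
  assumes "t + s < M" "q < N"
  shows "position M t q \<le> (N - 1) * M"
proof -
  have N: "s + 1 < N"
    using block_Suc[of 0] block_ge[of 1] a_pos[of 1] by simp
  have "owner (N - 1) = 1"
    using block_Suc[of 0] a_pos[of 1] by (intro owner_eqI) auto
  then have "position M t (N - 1) = edge_length M t (N - 1)"
    using N by (simp add: position_def spine_position_def)
  also have "\<dots> \<le> (N - 1) * M"
    using assms N by (intro edge_length_le) auto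
  finally have last: "position M t (N - 1) \<le> (N - 1) * M" .
  have "position M t q \<le> position M t (N - 1)"
    using position_strict_mono[OF assms(1), of q "N - 1"] assms(2) N
    by (metis One_nat_def Suc_pred le_less less_Suc_eq less_nat_zero_code not_gr_zero)
  then show ?thesis using last by (rule le_trans)
qed

text \<open>This yields both the size of each length set and the disjointness of different ones.
  Spine lengths are at most \<open>s * M\<close> and leaf lengths exceed it; within each kind,
  division with remainder by \<open>M\<close>, respectively by \<open>a (owner q)\<close>, recovers
  \<open>t\<close> and the edge.\<close>

lemma edge_length_inj:
  assumes t: "t < M" "t' < M" and q: "1 \<le> q" "q < N" "1 \<le> q'" "q' < N"
    and eq: "edge_length M t q = edge_length M t' q'"
  shows "t = t' \<and> q = q'"
proof -
  have spine: "edge_length M t q \<le> s * M" if "t < M" "1 \<le> q" "q \<le> s" for t q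
    using spine_length_le[of t M q] \<sigma>_range[of q] that
    by (meson atLeastAtMost_iff le_trans mult_le_mono1)
  have leaf: "s * M < edge_length M t q" if "s < q" for t q
  proof -
    have "s * M \<le> (block (owner q) - 1) * M"
      using block_ge[of "owner q"] by (intro mult_le_mono1) simp
    also have "\<dots> < edge_length M t q" using that by (simp add: edge_length_def)
    finally show ?thesis .
  qed
  have leaf_lower: "(block (owner q) - 1) * M < edge_length M t q" if "s < q" for t q
    using that by (simp add: edge_length_def)
  consider "q \<le> s" "q' \<le> s" | "s < q" "s < q'" | "q \<le> s" "s < q'" | "s < q" "q' \<le> s"
    by linarith
  then show ?thesis
  proof cases
    case 1
    then have eq: "(\<sigma> q - 1) * M + t = (\<sigma> q' - 1) * M + t'"
      using eq by (simp add: edge_length_def)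
    have "t = t'"
      using arg_cong[OF eq, of "\<lambda>x. x mod M"] t by simp
    moreover have "\<sigma> q - 1 = \<sigma> q' - 1"
      using arg_cong[OF eq, of "\<lambda>x. x div M"] t by simp
    then have "\<sigma> q = \<sigma> q'"
      using \<sigma>_range[of q] \<sigma>_range[of q'] 1 q by (simp add: eq_diff_iff)
    ultimately show ?thesis
      using permutes_inj[OF \<sigma>_permutes] by (auto dest: injD)
  next
    case 2
    have owner_le: "owner q' \<le> owner q"
      if "t < M" "t' < M" "s < q" "s < q'" "q < N" "q' < N"
        "edge_length M t q = edge_length M t' q'" for t t' q q'
    proof (rule ccontr)
      assume "\<not> ?thesis"
      then have "block (owner q' - 1) \<le> block (owner q)"
        by (intro block_antimono) simp
      then have "(block (owner q' - 1) - 1) * M \<le> (block (owner q) - 1) * M"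
        by (intro mult_le_mono1) simp
      then show False
        using leaf_length_le[of t' M q'] leaf_lower[of q t] that by linarith
    qed
    have own_eq: "owner q' = owner q"
      using owner_le[of t t' q q'] owner_le[of t' t q' q] t 2 q eq by simp
    note own = owner_props[OF 2(1) q(2)] owner_props[OF 2(2) q(4)]
    have eq: "a (owner q) * t + (q - block (owner q)) = a (owner q) * t' + (q' - block (owner q))"
      using eq 2 own_eq by (simp add: edge_length_def)
    have less: "q - block (owner q) < a (owner q)" "q' - block (owner q) < a (owner q)"
      using own own_eq by auto
    have "q - block (owner q) = q' - block (owner q)"
      using arg_cong[OF eq, of "\<lambda>x. x mod a (owner q)"] less by simp
    moreover have "t = t'"
      using arg_cong[OF eq, of "\<lambda>x. x div a (owner q)"] less by simp
    ultimately show ?thesis using own own_eq by simp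
  next
    case 3
    then show ?thesis using spine[of t q] leaf[of q' t'] eq t q by simp
  next
    case 4
    then show ?thesis using spine[of t' q'] leaf[of q t] eq t q by simp
  qed
qed

end

section \<open>Plane convex caterpillars\<close>

text \<open>A downward closed set of indices is determined by its size; this turns leaf counts into
  places in the listing.\<close>

lemma initial_segment_eq:
  fixes D :: "nat set"
  assumes "D \<subseteq> {m..<n}" and down: "\<And>j k. k \<in> D \<Longrightarrow> m \<le> j \<Longrightarrow> j < k \<Longrightarrow> j \<in> D"
  shows "D = {m..<m + card D}"
proof (cases "D = {}")
  case False
  have fin: "finite D" using assms(1) finite_subset by blast
  have "D = {m..<Suc (Max D)}"
  proof
    show "{m..<Suc (Max D)} \<subseteq> D"
      using down[OF Max_in[OF fin False]] Max_in[OF fin False] by (auto simp: less_Suc_eq)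
  qed (use assms(1) Max_ge[OF fin] in \<open>auto simp: less_Suc_eq_le\<close>)
  moreover from this have "card D = Suc (Max D) - m"
    by (metis card_atLeastLessThan)
  moreover have "m \<le> Max D"
    using assms(1) Max_in[OF fin False] by auto
  ultimately show ?thesis by simp
qed simp

text \<open>The only edge at a leaf leads to a non-leaf, that is, to a spine vertex. The equivalence
  packs existence and uniqueness of this edge together.\<close>

lemma leaf_spine_neighbour:
  assumes cat: "plane_convex_caterpillar G" and spine: "clockwise_spine G s v"
    and x: "leaf G x"
  shows "\<exists>i\<in>{1..s + 1}. \<forall>e. e \<in> edges G \<and> x \<in> e \<longleftrightarrow> e = {v i, x}"
proof -
  have cgg: "is_cgg G" and tree: "tree_cgg G"
    using cat by (auto simp: plane_convex_caterpillar_def plane_cgg_def)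
  have bij: "bij_betw v {1..s + 1} {x \<in> verts G. \<not> leaf G x}"
    using spine by (simp add: clockwise_spine_def delete_leaves_def)
  obtain e where e: "{e \<in> edges G. x \<in> e} = {e}"
    using x by (auto simp: leaf_def card_1_singleton_iff)
  have "e \<in> {e \<in> edges G. x \<in> e}" unfolding e by simp
  then obtain p q where pq: "e = {p, q}" "p \<noteq> q" "p \<in> verts G" "q \<in> verts G" "x \<in> {p, q}"
    using cgg unfolding is_cgg_def by auto
  then obtain y where y: "e = {x, y}" "y \<noteq> x" "y \<in> verts G"
    by auto
  \<comment> \<open>Two adjacent leaves would form a whole component, which could not contain
    \<open>v 1\<close>.\<close>
  have "\<not> leaf G y"
  proof
    assume "leaf G y"
    then obtain e' where "{e \<in> edges G. y \<in> e} = {e'}"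
      by (auto simp: leaf_def card_1_singleton_iff)
    moreover have "e \<in> {e \<in> edges G. y \<in> e}"
      using e y(1) by blast
    ultimately have e': "{e \<in> edges G. y \<in> e} = {e}" by simp
    have "v 1 \<in> verts G" "\<not> leaf G (v 1)"
      using bij by (auto simp: bij_betw_def)
    then have "(x, v 1) \<in> {(p, q). {p, q} \<in> edges G}\<^sup>*"
      using tree x by (auto simp: tree_cgg_def leaf_def)
    then have "v 1 \<in> {x, y}"
    proof induction
      case (step z z')
      then have "{z, z'} \<in> {e \<in> edges G. x \<in> e} \<union> {e \<in> edges G. y \<in> e}" by auto
      then have "{z, z'} = {x, y}"
        unfolding e e' y(1) by simp
      then show ?case by (auto simp: doubleton_eq_iff)
    qed simp
    then show False using x \<open>leaf G y\<close> \<open>\<not> leaf G (v 1)\<close> by auto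
  qed
  then obtain i where "i \<in> {1..s + 1}" "y = v i"
    using bij y(3) unfolding bij_betw_def by (metis (mono_tags, lifting) imageE mem_Collect_eq)
  moreover from this have "e = {v i, x}"
    using y(1) by (simp add: insert_commute)
  with e have "\<forall>e. e \<in> edges G \<and> x \<in> e \<longleftrightarrow> e = {v i, x}"
    by (simp add: set_eq_iff)
  ultimately show ?thesis by blast
qed

text \<open>\<open>clockwise_spine\<close> provides one inclusion; the other follows by counting, as
  a path on \<open>s + 1\<close> vertices has \<open>s\<close> edges.\<close>

lemma spine_edges_eq:
  assumes cat: "plane_convex_caterpillar G" and spine: "clockwise_spine G s v"
  shows "edges (delete_leaves G) = (\<lambda>i. {v i, v (i + 1)}) ` {1..s}"
proof -
  define D where "D = delete_leaves G"
  have bij: "bij_betw v {1..s + 1} (verts D)"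
    and sub: "(\<lambda>i. {v i, v (i + 1)}) ` {1..s} \<subseteq> edges D"
    using spine by (auto simp: clockwise_spine_def D_def)
  have "path_cgg D"
    using cat by (simp add: plane_convex_caterpillar_def convex_path_def D_def)
  then obtain ps where ps: "distinct ps" "verts D = set ps"
    "edges D = {{ps ! i, ps ! (i + 1)} | i. i + 1 < length ps}"
    unfolding path_cgg_def by (elim exE conjE) (rule that; assumption)
  have len: "length ps = s + 1"
    using bij_betw_same_card[OF bij] distinct_card[OF ps(1)] ps(2) by simp
  have edges: "edges D = (\<lambda>i. {ps ! i, ps ! (i + 1)}) ` {..<s}"
    unfolding ps(3) len by auto
  have inj: "inj_on v {1..s + 1}" using bij by (simp add: bij_betw_def)
  have "inj_on (\<lambda>i. {v i, v (i + 1)}) {1..s}"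
  proof (rule inj_onI)
    fix i j assume ij: "i \<in> {1..s}" "j \<in> {1..s}" "{v i, v (i + 1)} = {v j, v (j + 1)}"
    then have "v ` {i, i + 1} = v ` {j, j + 1}" by simp
    then have "{i, i + 1} = {j, j + 1}"
      using inj_on_image_eq_iff[OF inj, of "{i, i + 1}" "{j, j + 1}"] ij by simp
    then show "i = j" by (auto simp: doubleton_eq_iff)
  qed
  then have "card ((\<lambda>i. {v i, v (i + 1)}) ` {1..s}) = s"
    by (simp add: card_image)
  moreover have "card (edges D) \<le> s" "finite (edges D)"
    unfolding edges using card_image_le[of "{..<s}"] by simp_all
  ultimately show ?thesis
    using card_seteq[OF _ sub] by (simp add: D_def)
qed

text \<open>Successors are unique, so a listing that starts at \<open>v 1\<close> follows the spine,
  and having more than \<open>s\<close> entries it does not wrap around on the way. The shift arises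
  because listings start at 0 and the spine at 1.\<close>

lemma spine_listing:
  assumes us: "clockwise_listing (verts G) us" "us ! 0 = v 1" and spine: "clockwise_spine G s v"
    and "i \<le> s"
  shows "i < length us \<and> us ! i = v (i + 1)"
proof -
  have bij: "bij_betw v {1..s + 1} (verts (delete_leaves G))"
    and next_v: "\<And>i. i \<in> {1..s} \<Longrightarrow> clockwise_next (verts G) (v i) (v (i + 1))"
    using spine by (auto simp: clockwise_spine_def)
  have V: "set us = verts G" "distinct us"
    using us(1) by (auto simp: clockwise_listing_def)
  have sub: "v ` {1..s + 1} \<subseteq> set us"
    using bij V by (auto simp: bij_betw_def delete_leaves_def)
  then have "card (v ` {1..s + 1}) \<le> length us"
    using card_mono[OF _ sub] distinct_card[OF V(2)] by simp
  moreover have "inj_on v {1..s + 1}" using bij by (simp add: bij_betw_def)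
  ultimately have len: "s < length us" by (simp add: card_image)
  from \<open>i \<le> s\<close> have "us ! i = v (i + 1)"
  proof (induction i)
    case (Suc i)
    have "v (i + 2) \<in> set us" using sub Suc.prems by auto
    then obtain j where j: "j < length us" "us ! j = v (i + 2)"
      by (auto simp: in_set_conv_nth)
    have "v (i + 2) \<noteq> v (i + 1)"
      using inj_onD[OF \<open>inj_on v {1..s + 1}\<close>, of "i + 2" "i + 1"] Suc.prems by auto
    then have "i \<noteq> j"
      using Suc j by auto
    moreover have "clockwise_next (verts G) (us ! i) (us ! j)"
      using next_v[of "i + 1"] Suc j by simp
    ultimately have "j = (i + 1) mod length us"
      using clockwise_next_iff[OF us(1), of i j] j len Suc.prems by simp
    then show ?case using j len Suc.prems by simp
  qed (use us(2) in simp)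
  then show ?thesis using len assms(4) by simp
qed

context caterpillar_shape
begin

text \<open>Planarity forces the order of the leaves and the counts force the block sizes, so
  \<open>s\<close> and \<open>a\<close> alone determine the index pattern of the edges.\<close>

lemma caterpillar_listing:
  assumes cat: "plane_convex_caterpillar G" and spine: "clockwise_spine G s v"
    and leaves: "\<forall>i\<in>{1..s + 1}. card {x. leaf G x \<and> {v i, x} \<in> edges G} = a i"
  obtains us where "clockwise_listing (verts G) us" "length us = N"
    "edges G = (`) ((!) us) ` (\<lambda>q. {parent q, q}) ` {1..<N}"
proof -
  have cgg: "is_cgg G"
    and plane: "\<And>w x y z. {w, x} \<in> edges G \<Longrightarrow> {y, z} \<in> edges G \<Longrightarrow> {w, x} \<noteq> {y, z} \<Longrightarrow>
        open_segment w x \<inter> open_segment y z = {}"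
    using cat by (auto simp: plane_convex_caterpillar_def plane_cgg_def)
  have bij: "bij_betw v {1..s + 1} {x \<in> verts G. \<not> leaf G x}"
    using spine by (simp add: clockwise_spine_def delete_leaves_def)
  then have inj: "inj_on v {1..s + 1}" by (simp add: bij_betw_def)
  have v1: "v 1 \<in> verts G"
    using bij by (auto simp: bij_betw_def)
  then obtain us where us: "clockwise_listing (verts G) us" "us ! 0 = v 1"
    using clockwise_listing_exists cgg by (metis is_cgg_def)
  have V: "set us = verts G" "distinct us"
    using us(1) by (auto simp: clockwise_listing_def)
  define n where "n = length us"
  have spine_nth: "i < n" "us ! i = v (i + 1)" if "i \<le> s" for i
    using spine_listing[OF us spine that] by (auto simp: n_def)
  have leaf_nth: "leaf G (us ! j)" if "s < j" "j < n" for j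
  proof (rule ccontr)
    assume "\<not> leaf G (us ! j)"
    moreover have "us ! j \<in> verts G" using that V(1) nth_mem[of j us] by (simp add: n_def)
    ultimately have "us ! j \<in> v ` {1..s + 1}" using bij by (auto simp: bij_betw_def)
    then obtain i where "i \<in> {1..s + 1}" "us ! j = v i" by blast
    then have "us ! j = us ! (i - 1)" "i - 1 \<le> s"
      using spine_nth[of "i - 1"] by auto
    then show False
      using that V(2) spine_nth(1)[of "i - 1"] by (simp add: nth_eq_iff_index_eq n_def)
  qed
  have spine_not_leaf: "\<not> leaf G (v i)" if "i \<in> {1..s + 1}" for i
    using bij that by (auto simp: bij_betw_def)
  have leaf_index: "\<exists>j. s < j \<and> j < n \<and> x = us ! j" if "leaf G x" for x
  proof -
    have "x \<in> set us" using that V(1) by (simp add: leaf_def)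
    then obtain j where "j < n" "x = us ! j" by (metis in_set_conv_nth n_def)
    moreover have "\<not> j \<le> s"
      using spine_nth(2)[of j] spine_not_leaf[of "j + 1"] that \<open>x = us ! j\<close> by auto
    ultimately show ?thesis by (metis not_le)
  qed
  \<comment> \<open>The index of the spine neighbour of the leaf \<open>us ! j\<close>.\<close>
  define w where "w j = (SOME i. i \<in> {1..s + 1} \<and>
    (\<forall>e. e \<in> edges G \<and> us ! j \<in> e \<longleftrightarrow> e = {v i, us ! j}))" for j
  have w: "w j \<in> {1..s + 1}" "\<And>e. e \<in> edges G \<and> us ! j \<in> e \<longleftrightarrow> e = {v (w j), us ! j}"
    if "s < j" "j < n" for j
    using someI_ex[OF leaf_spine_neighbour[OF cat spine leaf_nth[OF that], unfolded Bex_def]]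
    unfolding w_def[symmetric] by auto
  have w_edge: "{v (w j), us ! j} \<in> edges G" if "s < j" "j < n" for j
    using w(2)[OF that] by blast
  have w_unique: "i = w j" if "s < j" "j < n" "i \<in> {1..s + 1}" "{v i, us ! j} \<in> edges G" for i j
  proof -
    have "{v i, us ! j} = {v (w j), us ! j}" using w(2)[OF that(1,2), of "{v i, us ! j}"] that(4) by simp
    then have "v i = v (w j)" by (auto simp: doubleton_eq_iff)
    then show ?thesis using inj w(1)[OF that(1,2)] that(3) by (auto dest: inj_onD)
  qed
  \<comment> \<open>Otherwise the four ends occur as spine, spine, leaf, leaf in the listing, and
    the two edges are crossing chords.\<close>
  have antimono: "w k \<le> w j" if jk: "s < j" "j < k" "k < n" for j k
  proof (rule ccontr)
    assume less: "\<not> w k \<le> w j"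
    define p q where "p = w j - 1" and "q = w k - 1"
    have pq: "p < q" "q \<le> s" "v (w j) = us ! p" "v (w k) = us ! q"
      using w(1)[of j] w(1)[of k] jk less spine_nth(2)[of p] spine_nth(2)[of q]
      by (auto simp: p_def q_def)
    then have "open_segment (us ! p) (us ! j) \<inter> open_segment (us ! q) (us ! k) \<noteq> {}"
      using us(1) jk by (intro crossing_chords clockwise_triple_cyclic[OF us(1)]) (auto simp: n_def)
    moreover have "{us ! p, us ! j} \<noteq> {us ! q, us ! k}"
      using V(2) pq jk by (auto simp: doubleton_eq_iff nth_eq_iff_index_eq n_def)
    ultimately show False
      using plane[OF w_edge[of j] w_edge[of k]] jk pq by simp
  qed
  define J where "J i = {j \<in> {s + 1..<n}. w j = i}" for i
  have card_J: "card (J i) = a i" if i: "i \<in> {1..s + 1}" for i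
  proof -
    have "bij_betw ((!) us) (J i) {x. leaf G x \<and> {v i, x} \<in> edges G}"
      unfolding bij_betw_def
    proof
      show "inj_on ((!) us) (J i)"
        using V(2) by (auto simp: inj_on_def J_def nth_eq_iff_index_eq n_def)
      show "(!) us ` J i = {x. leaf G x \<and> {v i, x} \<in> edges G}"
      proof
        show "(!) us ` J i \<subseteq> {x. leaf G x \<and> {v i, x} \<in> edges G}"
          using leaf_nth w_edge by (auto simp: J_def)
        show "{x. leaf G x \<and> {v i, x} \<in> edges G} \<subseteq> (!) us ` J i"
        proof
          fix x assume x: "x \<in> {x. leaf G x \<and> {v i, x} \<in> edges G}"
          then obtain j where j: "s < j" "j < n" "x = us ! j"
            using leaf_index by blast
          then show "x \<in> (!) us ` J i"
            using w_unique[of j i] x j i by (auto simp: J_def)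
        qed
      qed
    qed
    then show ?thesis using leaves i bij_betw_same_card by force
  qed
  \<comment> \<open>By \<open>antimono\<close> these leaves come first, and the leaf counts show
    that there are \<open>block i - (s + 1)\<close> of them.\<close>
  have above: "{j \<in> {s + 1..<n}. i < w j} = {s + 1..<block i}" for i
  proof -
    define U where "U = {j \<in> {s + 1..<n}. i < w j}"
    have "U = (\<Union>k\<in>{i<..s + 1}. J k)"
      using w(1) by (fastforce simp: U_def J_def)
    then have "card U = (\<Sum>k\<in>{i<..s + 1}. card (J k))"
      by (auto simp: J_def intro!: card_UN_disjoint)
    also have "\<dots> = (\<Sum>k\<in>{i<..s + 1}. a k)"
      using card_J by (intro sum.cong) auto
    finally have "s + 1 + card U = block i"
      by (simp add: block_def)
    moreover have "U = {s + 1..<s + 1 + card U}"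
    proof (rule initial_segment_eq)
      show "U \<subseteq> {s + 1..<n}" by (auto simp: U_def)
      fix j k assume "k \<in> U" "s + 1 \<le> j" "j < k"
      then show "j \<in> U"
        using antimono[of j k] by (auto simp: U_def)
    qed
    ultimately show ?thesis by (simp add: U_def)
  qed
  \<comment> \<open>For \<open>i = 0\<close> the set in \<open>above\<close> contains every leaf,
    which gives the total number of vertices.\<close>
  have "0 < w j" if "j \<in> {s + 1..<n}" for j
    using w(1)[of j] that by simp
  then have "{j \<in> {s + 1..<n}. 0 < w j} = {s + 1..<n}" by blast
  then have "{s + 1..<n} = {s + 1..<N}" using above[of 0] by simp
  then have "card {s + 1..<n} = card {s + 1..<N}" by simp
  then have n: "n = N"
    using block_ge[of 0] spine_nth(1)[of s] by simp
  have owner_w: "owner j = w j" if j: "s < j" "j < N" for j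
  proof (rule owner_eqI)
    show "1 \<le> w j" using w(1)[of j] j n by simp
    show "block (w j) \<le> j" using above[of "w j"] j n by (force simp: not_less set_eq_iff)
    have "j \<in> {k \<in> {s + 1..<n}. w j - 1 < w k}" using j n \<open>1 \<le> w j\<close> by simp
    then show "j < block (w j - 1)" unfolding above by simp
  qed
  have spine_edge: "(!) us ` {parent q, q} = {v q, v (q + 1)}" if "1 \<le> q" "q \<le> s" for q
    using spine_nth(2)[of q] spine_nth(2)[of "q - 1"] that by (simp add: parent_def)
  have leaf_edge: "(!) us ` {parent q, q} = {v (w q), us ! q}" if "s < q" "q < N" for q
  proof -
    have "w q \<in> {1..s + 1}" using w(1)[of q] that n by simp
    then have "us ! (w q - 1) = v (w q)"
      using spine_nth(2)[of "w q - 1"] by auto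
    then show ?thesis using owner_w[OF that] that by (simp add: parent_def)
  qed
  have edge_in: "(!) us ` {parent q, q} \<in> edges G" if q: "q \<in> {1..<N}" for q
  proof (cases "q \<le> s")
    case True
    then show ?thesis
      using spine_edge[of q] q spine by (simp add: clockwise_spine_def delete_leaves_def)
  next
    case False
    then show ?thesis
      using leaf_edge[of q] w_edge[of q] q n by simp
  qed
  \<comment> \<open>An edge with a leaf end is the only edge at that leaf; any other edge survives
    the deletion of leaves and belongs to the spine.\<close>
  have edge_of: "e \<in> (`) ((!) us) ` (\<lambda>q. {parent q, q}) ` {1..<N}" if e: "e \<in> edges G" for e
  proof (cases "\<exists>x\<in>e. leaf G x")
    case True
    then obtain x where x: "x \<in> e" "leaf G x" by blast
    then obtain j where j: "s < j" "j < n" "x = us ! j"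
      using leaf_index by blast
    then have "e = (!) us ` {parent j, j}"
      using leaf_edge[of j] w(2)[of j e] x j n e by simp
    then show ?thesis
      unfolding image_image using j n by (intro image_eqI[of _ _ j]) simp_all
  next
    case False
    then have "e \<in> edges (delete_leaves G)"
      using e by (auto simp: delete_leaves_def)
    then obtain i where "i \<in> {1..s}" "e = {v i, v (i + 1)}"
      unfolding spine_edges_eq[OF cat spine] by blast
    then show ?thesis
      unfolding image_image using spine_edge[of i] block_ge[of 0]
      by (intro image_eqI[of _ _ i]) simp_all
  qed
  have "edges G = (`) ((!) us) ` (\<lambda>q. {parent q, q}) ` {1..<N}"
  proof
    show "(`) ((!) us) ` (\<lambda>q. {parent q, q}) ` {1..<N} \<subseteq> edges G"
      unfolding image_image using edge_in by (rule image_subsetI)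
    show "edges G \<subseteq> (`) ((!) us) ` (\<lambda>q. {parent q, q}) ` {1..<N}"
      using edge_of by (rule subsetI)
  qed
  then show ?thesis by (rule that[OF us(1) n[unfolded n_def]])
qed

section \<open>Copies in the complete graph and the packing\<close>

lemma parent_edge_inj: "inj_on (\<lambda>q. {parent q, q}) {1..<N}"
proof (rule inj_onI)
  fix p q assume "p \<in> {1..<N}" "q \<in> {1..<N}" "{parent p, p} = {parent q, q}"
  then show "p = q"
    using parent_props(1)[of p] parent_props(1)[of q] by (auto simp: doubleton_eq_iff)
qed

lemma parent_edge_subset: "(\<lambda>q. {parent q, q}) ` {1..<N} \<subseteq> Pow {..<N}"
proof
  fix p assume "p \<in> (\<lambda>q. {parent q, q}) ` {1..<N}"
  then obtain q where "q \<in> {1..<N}" "p = {parent q, q}" by blast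
  then show "p \<in> Pow {..<N}" using parent_props(1)[of q] by simp
qed

text \<open>Vertex \<open>q\<close> goes to entry \<open>position M t q\<close> of a listing of
  \<open>K\<close>. Increasing positions keep the chosen entries clockwise, so the common index
  pattern gives the isomorphism.\<close>

lemma copy_exists:
  assumes us: "clockwise_listing (verts G) us" "length us = N"
    and edges: "edges G = (`) ((!) us) ` (\<lambda>q. {parent q, q}) ` {1..<N}"
    and K: "complete_cgg n K" and t: "t + s < M" and n: "(N - 1) * M \<le> n div 2"
  shows "\<exists>H. sub_cgg H K \<and> convex_isomorphic H G \<and> length_set K H = edge_length M t ` {1..<N}"
proof -
  have N: "1 < N" using block_ge[of 0] s_pos by simp
  then have "0 < (N - 1) * M" using t by simp
  \<comment> \<open>Rules out \<open>n = 0\<close>, so that positions up to \<open>n div 2\<close>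
    are valid indices.\<close>
  then have n_pos: "n div 2 < n" using n by linarith
  have cggK: "is_cgg K" "finite (verts K)" "card (verts K) = n"
    using K by (auto simp: complete_cgg_def is_cgg_def)
  then have "verts K \<noteq> {}" using n_pos by auto
  then obtain ks where ks: "clockwise_listing (verts K) ks"
    using clockwise_listing_exists cggK(1) unfolding is_cgg_def by (metis ex_in_conv)
  have len_ks: "length ks = n" "distinct ks" "set ks = verts K"
    using ks cggK distinct_card[of ks] by (auto simp: clockwise_listing_def)
  define pos where "pos = position M t"
  have pos_less: "pos q < n" if "q < N" for q
    using position_le[OF t that] n n_pos by (simp add: pos_def)
  have pos_mono: "pos p < pos q" if "p < q" "q < N" for p q
    using position_strict_mono[OF t that] by (simp add: pos_def)
  define hs where "hs = map (\<lambda>q. ks ! pos q) [0..<N]"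
  have hs_nth: "length hs = N" "hs ! q = ks ! pos q" if "q < N" for q
    using that by (simp_all add: hs_def)
  have len_hs: "length hs = N" by (simp add: hs_def)
  have in_K: "hs ! q \<in> verts K" if "q < N" for q
    using pos_less[OF that] len_ks hs_nth[OF that] by (metis nth_mem)
  have sub: "set hs \<subseteq> verts K"
    using in_K len_hs by (auto simp: in_set_conv_nth)
  have "distinct hs"
    unfolding distinct_conv_nth len_hs
  proof (intro allI impI)
    fix i j assume ij: "i < N" "j < N" "i \<noteq> j"
    then have "pos i \<noteq> pos j"
      using pos_mono[of i j] pos_mono[of j i] by (cases "i < j") auto
    then show "hs ! i \<noteq> hs ! j"
      using ij pos_less len_ks by (simp add: hs_nth nth_eq_iff_index_eq)
  qed
  define H where "H = \<lparr>verts = set hs, edges = (`) ((!) hs) ` (\<lambda>q. {parent q, q}) ` {1..<N}\<rparr>"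
  have edges_H: "edges H = (\<lambda>q. {hs ! parent q, hs ! q}) ` {1..<N}"
    by (simp add: H_def image_image)
  have hs: "clockwise_listing (verts H) hs"
    unfolding clockwise_listing_def
  proof (intro conjI allI impI)
    fix i j k assume "i < j \<and> j < k \<and> k < length hs"
    then show "clockwise_triple (hs ! i) (hs ! j) (hs ! k)"
      using clockwise_triple_cyclic[OF ks, of "pos i" "pos j" "pos k"] pos_mono pos_less len_ks(1) len_hs
      by (simp add: hs_nth)
  qed (simp_all add: H_def \<open>distinct hs\<close>)
  have edge_ends: "hs ! parent q \<in> set hs" "hs ! q \<in> set hs" "hs ! parent q \<noteq> hs ! q"
    if "q \<in> {1..<N}" for q
    using parent_props(1)[of q] that \<open>distinct hs\<close> len_hs by (auto simp: nth_eq_iff_index_eq)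
  have "is_cgg H"
    unfolding is_cgg_def
  proof (intro conjI)
    show "strictly_convex_position (verts H)"
      using strictly_convex_position_subset cggK(1) sub by (auto simp: is_cgg_def H_def)
    show "\<forall>e\<in>edges H. \<exists>x\<in>verts H. \<exists>y\<in>verts H. x \<noteq> y \<and> e = {x, y}"
    proof
      fix e assume "e \<in> edges H"
      then obtain q where "q \<in> {1..<N}" "e = {hs ! parent q, hs ! q}" by (auto simp: edges_H)
      then show "\<exists>x\<in>verts H. \<exists>y\<in>verts H. x \<noteq> y \<and> e = {x, y}"
        using edge_ends[of q] by (auto simp: H_def)
    qed
  qed (simp add: H_def)
  moreover have "edges H \<subseteq> edges K"
  proof
    fix e assume "e \<in> edges H"
    then obtain q where q: "q \<in> {1..<N}" "e = {hs ! parent q, hs ! q}" by (auto simp: edges_H)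
    have "edges K = {{x, y} | x y. x \<in> verts K \<and> y \<in> verts K \<and> x \<noteq> y}"
      using K by (simp add: complete_cgg_def)
    then show "e \<in> edges K"
      using edge_ends[OF q(1)] sub q(2) by blast
  qed
  ultimately have "sub_cgg H K"
    using sub by (simp add: sub_cgg_def H_def)
  moreover have "convex_isomorphic H G"
    using convex_isomorphic_listing[OF hs us(1)] parent_edge_subset us(2) len_hs edges
    by (simp add: H_def)
  moreover have len: "pair_length (verts K) (hs ! parent q) (hs ! q) = edge_length M t q"
    "pair_length (verts K) (hs ! q) (hs ! parent q) = edge_length M t q" if q: "q \<in> {1..<N}" for q
  proof -
    have par: "parent q < q" "q < N" "parent q < N" using parent_props(1)[of q] q by auto
    have pos_eq: "pos q = pos (parent q) + edge_length M t q"
      using position_parent[of q] q by (simp add: pos_def)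
    \<comment> \<open>At most half of the cycle, so the arc from \<open>pos (parent q)\<close> to
      \<open>pos q\<close> is a shortest one.\<close>
    have "edge_length M t q \<le> n div 2"
      using edge_length_le[of t M q] q t n by simp
    then have "cyclic_distance n (pos (parent q)) (pos q) = edge_length M t q"
      unfolding cyclic_distance_def pos_eq by simp
    then show "pair_length (verts K) (hs ! parent q) (hs ! q) = edge_length M t q"
      "pair_length (verts K) (hs ! q) (hs ! parent q) = edge_length M t q"
      using pair_length_listing[OF ks] pos_less par len_ks(1)
      by (simp_all add: hs_nth cyclic_distance_commute)
  qed
  have "length_set K H = edge_length M t ` {1..<N}"
  proof
    show "length_set K H \<subseteq> edge_length M t ` {1..<N}"
      using len by (auto simp: length_set_def edges_H doubleton_eq_iff)
    show "edge_length M t ` {1..<N} \<subseteq> length_set K H"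
    proof
      fix l assume "l \<in> edge_length M t ` {1..<N}"
      then obtain q where q: "q \<in> {1..<N}" "l = edge_length M t q" by blast
      then have "{hs ! parent q, hs ! q} \<in> edges H"
        unfolding edges_H by blast
      then show "l \<in> length_set K H"
        using len(1)[OF q(1)] q(2) unfolding length_set_def
        by (intro CollectI exI[of _ "hs ! parent q"] exI[of _ "hs ! q"]) simp
    qed
  qed
  ultimately show ?thesis by blast
qed

text \<open>Different \<open>t\<close> give disjoint sets of \<open>e\<close> lengths, and together
  they miss only a bounded number of the available lengths.\<close>

lemma strongly_packable_if_listing:
  assumes us: "clockwise_listing (verts G) us" "length us = N"
    and edges: "edges G = (`) ((!) us) ` (\<lambda>q. {parent q, q}) ` {1..<N}"
  shows "strongly_packable G"
proof -
  define e where "e = N - 1"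
  have e: "1 \<le> e" "card {1..<N} = e" using block_ge[of 0] s_pos by (simp_all add: e_def)
  have "inj_on ((!) us) {..<N}"
    using us by (auto simp: inj_on_def clockwise_listing_def nth_eq_iff_index_eq)
  then have "inj_on ((`) ((!) us)) (Pow {..<N})"
    by (rule inj_on_image_Pow)
  then have "inj_on ((`) ((!) us)) ((\<lambda>q. {parent q, q}) ` {1..<N})"
    using parent_edge_subset by (rule inj_on_subset)
  then have card_edges: "card (edges G) = e"
    unfolding edges using parent_edge_inj e(2) by (simp add: card_image)
  define M where "M n = (n div 2) div e" for n :: nat
  have M_le: "e * M n \<le> n div 2" for n
    unfolding M_def by (rule times_div_less_eq_dividend)
  define A where "A n t = edge_length (M n) t ` {1..<N}" for n t
  \<comment> \<open>Truncated subtraction makes \<open>S n\<close> empty as long as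
    \<open>M n \<le> s\<close>.\<close>
  define S where "S n = A n ` {..<M n - s}" for n
  have card_A: "card (A n t) = e" if "t < M n - s" for n t
  proof -
    have "inj_on (edge_length (M n) t) {1..<N}"
      using edge_length_inj[of t "M n" t] that by (intro inj_onI) auto
    then show ?thesis unfolding A_def using e(2) by (simp only: card_image)
  qed
  have disj: "disjnt (A n t) (A n t')" if "t < M n - s" "t' < M n - s" "t \<noteq> t'" for n t t'
  proof -
    have "edge_length (M n) t q \<noteq> edge_length (M n) t' q'" if "q \<in> {1..<N}" "q' \<in> {1..<N}" for q q'
      using edge_length_inj[of t "M n" t' q q'] that \<open>t \<noteq> t'\<close>
        less_le_trans[OF \<open>t < _\<close> diff_le_self] less_le_trans[OF \<open>t' < _\<close> diff_le_self] by auto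
    then show ?thesis by (force simp: A_def disjnt_iff)
  qed
  have inj_A: "inj_on (A n) {..<M n - s}" for n
  proof (rule inj_onI, rule ccontr)
    fix t t' assume "t \<in> {..<M n - s}" "t' \<in> {..<M n - s}" "A n t = A n t'" "t \<noteq> t'"
    then have "A n t = {}" using disj[of t n t'] by (simp add: disjnt_def)
    then show False using card_A[of t n] \<open>t \<in> _\<close> e(1) by simp
  qed
  have sum_S: "(\<Sum>B\<in>S n. card B) = (M n - s) * e" for n
    unfolding S_def sum.reindex[OF inj_A] using card_A by simp
  \<comment> \<open>The value forced by the required equation, so only its convergence is left to
    show.\<close>
  define \<epsilon> where "\<epsilon> n = 1 - real ((M n - s) * e) / (real n / 2)" for n
  have lim: "\<epsilon> \<longlonglongrightarrow> 0"
  proof (rule tendsto_sandwich)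
    show "\<forall>\<^sub>F n in sequentially. 0 \<le> \<epsilon> n"
    proof (intro eventually_sequentiallyI)
      fix n :: nat assume "1 \<le> n"
      have "(M n - s) * e \<le> n div 2"
        using M_le[of n] by (metis diff_le_self le_trans mult.commute mult_le_mono1)
      then have "real ((M n - s) * e) \<le> real n / 2" by linarith
      then show "0 \<le> \<epsilon> n" using \<open>1 \<le> n\<close> by (simp add: \<epsilon>_def field_simps)
    qed
    show "\<forall>\<^sub>F n in sequentially. \<epsilon> n \<le> real (1 + 2 * e + 2 * s * e) / real n"
    proof (intro eventually_sequentiallyI)
      fix n :: nat assume "1 \<le> n"
      \<comment> \<open>The losses, doubled: at most 1 from the parity of \<open>n\<close>, less
        than \<open>2 * e\<close> from the division by \<open>e\<close>, and at most
        \<open>2 * s * e\<close> from the excluded values of \<open>t\<close>.\<close>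
      have "n div 2 = e * M n + (n div 2) mod e" unfolding M_def by simp
      moreover have "(n div 2) mod e < e" using e(1) by simp
      moreover have "e * M n \<le> (M n - s) * e + s * e"
        by (cases "s \<le> M n") (auto simp: algebra_simps diff_mult_distrib2 intro: mult_le_mono2)
      ultimately have "n \<le> 2 * ((M n - s) * e) + (1 + 2 * e + 2 * s * e)" by linarith
      moreover have "\<epsilon> n \<le> real c / real n" if "\<epsilon> n = 1 - real m / (real n / 2)" "n \<le> 2 * m + c" for m c
      proof -
        have "real n \<le> 2 * real m + real c" using that(2) by linarith
        then have "real n / real n \<le> (2 * real m + real c) / real n" by (intro divide_right_mono) simp_all
        then show ?thesis using \<open>1 \<le> n\<close> by (simp add: that(1) add_divide_distrib)
      qed
      ultimately show "\<epsilon> n \<le> real (1 + 2 * e + 2 * s * e) / real n"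
        using \<epsilon>_def by blast
    qed
    show "(\<lambda>n. real (1 + 2 * e + 2 * s * e) / real n) \<longlonglongrightarrow> 0"
      by (rule lim_const_over_n)
  qed simp
  have sum_eq: "real (\<Sum>B\<in>S n. card B) = (1 - \<epsilon> n) * (real n / 2)" if "1 \<le> n" for n
    using that by (simp add: sum_S \<epsilon>_def)
  have lengths: "B \<subseteq> {1..n div 2} \<and> card B = card (edges G)" if "B \<in> S n" for B n
  proof -
    obtain t where t: "t < M n - s" "B = A n t" using \<open>B \<in> S n\<close> by (auto simp: S_def)
    have "edge_length (M n) t q \<in> {1..n div 2}" if "q \<in> {1..<N}" for q
    proof -
      have "edge_length (M n) t q \<le> e * M n"
        using edge_length_le[of t "M n" q] that t(1) by (simp add: e_def)
      then show ?thesis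
        using edge_length_pos[of "M n" t q] M_le[of n] by simp
    qed
    then show ?thesis using t card_A card_edges by (auto simp: A_def)
  qed
  have disj_S: "pairwise disjnt (S n)" for n
    using disj by (auto simp: S_def pairwise_def)
  have copies: "\<exists>H. sub_cgg H K \<and> convex_isomorphic H G \<and> length_set K H = B"
    if "complete_cgg n K" "B \<in> S n" for n K B
  proof -
    obtain t where t: "t < M n - s" "B = A n t" using \<open>B \<in> S n\<close> by (auto simp: S_def)
    then show ?thesis
      using copy_exists[OF us edges that(1), of t "M n"] M_le[of n] by (simp add: A_def e_def)
  qed
  have "\<exists>\<epsilon> :: nat \<Rightarrow> real. \<epsilon> \<longlonglongrightarrow> 0 \<and>
      (\<forall>n\<ge>1. real (\<Sum>B\<in>S n. card B) = (1 - \<epsilon> n) * (real n / 2))"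
    using lim sum_eq by (intro exI[of _ \<epsilon>] conjI allI impI)
  then show ?thesis
    unfolding strongly_packable_def
    using lengths disj_S copies by (intro exI[of _ S] conjI allI ballI impI) simp_all
qed

end

theorem theorem12:
  fixes s :: nat and a :: "nat \<Rightarrow> nat" and v :: "nat \<Rightarrow> complex" and G :: cgg
  assumes "1 \<le> s"
    and "\<forall>i\<in>{1..s + 1}. 1 \<le> a i"
    and "plane_convex_caterpillar G"
    and "clockwise_spine G s v"
    and "\<forall>i\<in>{1..s + 1}. card {x. leaf G x \<and> {v i, x} \<in> edges G} = a i"
    and "\<exists>\<sigma>. \<sigma> permutes {1..s} \<and> (\<forall>i\<in>{1..s}. \<sigma> i \<le> min (a i) (a (i + 1)))"
  shows "strongly_packable G"
proof -
  obtain \<sigma> where "\<sigma> permutes {1..s}" "\<forall>i\<in>{1..s}. \<sigma> i \<le> min (a i) (a (i + 1))"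
    using assms(6) by blast
  then interpret caterpillar_shape s a \<sigma>
    using assms(1,2) by unfold_locales auto
  show ?thesis
    using caterpillar_listing[OF assms(3-5)] strongly_packable_if_listing by metis
qed

end
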